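(* The capacitance matrix $\mathcal C=(\mathcal C_{ij})_{1\le i,j\le N}$ of a structure of $N$ concentric nested spherical-shell resonators in $\mathbb R^3$ is given by $$\mathcal C_{ij}=-4\pi\frac{r_{j-1}^-r_j^+}{r_{j-1}^--r_j^+}\,\delta_{i,j-1}+4\pi\left(\frac{r_{j-1}^-r_j^+}{r_{j-1}^--r_j^+}+\frac{r_j^-r_{j+1}^+}{r_j^--r_{j+1}^+}\right)\delta_{i,j}-4\pi\frac{r_j^-r_{j+1}^+}{r_j^--r_{j+1}^+}\,\delta_{i,j+1},$$ with the conventions $r_{N+1}^+=0$ and $r_0^-\to+\infty$ (so that $\frac{r_0^-r_1^+}{r_0^--r_1^+}$ is read as $r_1^+$ and $\frac{r_N^-r_{N+1}^+}{r_N^--r_{N+1}^+}$ as $0$). In particular $\mathcal C$ is symmetric and tridiagonal, with diagonal entries $4\pi\bigl(r_1^++\frac{r_1^-r_2^+}{r_1^--r_2^+}\bigr)$, $4\pi\bigl(\frac{r_{j-1}^-r_j^+}{r_{j-1}^--r_j^+}+\frac{r_j^-r_{j+1}^+}{r_j^--r_{j+1}^+}\bigr)$ for $2\le j\le N-1$, $4\pi\frac{r_{N-1}^-r_N^+}{r_{N-1}^--r_N^+}$ (for $N\geq 2$), and off-diagonal entries $\mathcal C_{j,j+1}=\mathcal C_{j+1,j}=-4\pi\frac{r_j^-r_{j+1}^+}{r_j^--r_{j+1}^+}$ for $1\le j\le N-1$.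
   Context: Fix $N\ge1$ and radii $r_1^+>r_1^->r_2^+>r_2^->\dots>r_N^+>r_N^->0$. Let $D_j=\{x\in\mathbb R^3: r_j^-\le|x|\le r_j^+\}$, $D=\bigcup_{j=1}^ND_j$, $\Gamma_j^\pm=\{|x|=r_j^\pm\}$, $\nu=x/|x|$. For $1\le j\le N$ let $V_j:\mathbb R^3\to\mathbb R$ be the (continuous) solution of $$-\Delta V_j=0\ \text{in }\mathbb R^3\setminus D,\qquad V_j=\delta_{i,j}\ \text{in }D_i\ (1\le i\le N),\qquad V_j(x)=O(|x|^{-1})\ \text{as }|x|\to\infty .$$ The capacitance matrix is defined by $$\mathcal C_{ij}=-\Bigl(\int_{\Gamma_i^+}\frac{\partial V_j}{\partial\nu}\,\mathrm d\sigma-\int_{\Gamma_i^-}\frac{\partial V_j}{\partial\nu}\,\mathrm d\sigma\Bigr),$$ where the normal derivatives are taken from the side of $\mathbb R^3\setminus D$. $\delta_{i,j}$ is the Kronecker delta. *)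

theory Defs
  imports "HOL-Analysis.Analysis" "HOL-Library.Landau_Symbols"
begin

definition partial_deriv :: "'n::finite \<Rightarrow> (real^'n \<Rightarrow> real) \<Rightarrow> real^'n \<Rightarrow> real" where
  "partial_deriv k u x = deriv (\<lambda>t. u (x + t *\<^sub>R axis k 1)) 0"

definition laplacian :: "(real^'n::finite \<Rightarrow> real) \<Rightarrow> real^'n \<Rightarrow> real" where
  "laplacian u x = (\<Sum>k\<in>UNIV. partial_deriv k (partial_deriv k u) x)"

(* Used for open S only. *)
definition C2_on :: "(real^'n::finite) set \<Rightarrow> (real^'n \<Rightarrow> real) \<Rightarrow> bool" where
  "C2_on S u \<longleftrightarrow>
     (\<forall>x\<in>S. u differentiable (at x)) \<and>
     (\<forall>k. \<forall>x\<in>S. partial_deriv k u differentiable (at x)) \<and>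
     (\<forall>k l. continuous_on S (partial_deriv l (partial_deriv k u)))"

definition harmonic_on :: "(real^'n::finite) set \<Rightarrow> (real^'n \<Rightarrow> real) \<Rightarrow> bool" where
  "harmonic_on S u \<longleftrightarrow> C2_on S u \<and> (\<forall>x\<in>S. - laplacian u x = 0)"

definition spherical_point :: "real \<Rightarrow> real \<times> real \<Rightarrow> real^3" where
  "spherical_point r = (\<lambda>(\<theta>, \<phi>).
     vector [r * sin \<theta> * cos \<phi>, r * sin \<theta> * sin \<phi>, r * cos \<theta>])"

(* The surface measure of the sphere of radius r > 0 about the origin, as a measure on the
   Borel sets of the whole space: the image of the area element r^2 sin \<theta> d\<theta> d\<phi> under
   spherical coordinates. *)
definition sphere_measure :: "real \<Rightarrow> (real^3) measure" where
  "sphere_measure r =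
     distr (density lborel
             (\<lambda>(\<theta>, \<phi>). ennreal (indicator ({0..pi} \<times> {0..2 * pi}) (\<theta>, \<phi>) * (r\<^sup>2 * sin \<theta>))))
           borel (spherical_point r)"

(* Radii are indexed by 1, ..., N; values at other indices are irrelevant. *)

definition shell :: "(nat \<Rightarrow> real) \<Rightarrow> (nat \<Rightarrow> real) \<Rightarrow> nat \<Rightarrow> (real^3) set" where
  "shell rp rm j = {x. rm j \<le> norm x \<and> norm x \<le> rp j}"

definition resonators :: "nat \<Rightarrow> (nat \<Rightarrow> real) \<Rightarrow> (nat \<Rightarrow> real) \<Rightarrow> (real^3) set" where
  "resonators N rp rm = (\<Union>j\<in>{1..N}. shell rp rm j)"

definition is_potential ::
  "nat \<Rightarrow> (nat \<Rightarrow> real) \<Rightarrow> (nat \<Rightarrow> real) \<Rightarrow> nat \<Rightarrow> (real^3 \<Rightarrow> real) \<Rightarrow> bool" where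
  "is_potential N rp rm j V \<longleftrightarrow>
     continuous_on UNIV V \<and>
     harmonic_on (- resonators N rp rm) V \<and>
     (\<forall>i\<in>{1..N}. \<forall>x\<in>shell rp rm i. V x = (if i = j then 1 else 0)) \<and>
     V \<in> O[at_infinity](\<lambda>x. 1 / norm x)"

definition potential ::
  "nat \<Rightarrow> (nat \<Rightarrow> real) \<Rightarrow> (nat \<Rightarrow> real) \<Rightarrow> nat \<Rightarrow> real^3 \<Rightarrow> real" where
  "potential N rp rm j = (THE V. is_potential N rp rm j V)"

(* Derivative at x of u along the radial unit vector x / norm x, taken from the side of the
   complement of D: the parameter t is restricted to those values for which the point on the
   ray lies outside D.  For D the union of the shells this is the derivative from the right
   (t > 0) at an outer boundary point and from the left (t < 0) at an inner one. *)
definition normal_derivative :: "(real^3) set \<Rightarrow> (real^3 \<Rightarrow> real) \<Rightarrow> real^3 \<Rightarrow> real" where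
  "normal_derivative D u x =
     vector_derivative (\<lambda>t. u (x + t *\<^sub>R (x /\<^sub>R norm x)))
       (at 0 within {t. x + t *\<^sub>R (x /\<^sub>R norm x) \<notin> D})"

definition boundary_flux :: "(real^3) set \<Rightarrow> (real^3 \<Rightarrow> real) \<Rightarrow> real \<Rightarrow> real" where
  "boundary_flux D u r =
     (LINT x:sphere 0 r|sphere_measure r. normal_derivative D u x)"

definition capacitance ::
  "nat \<Rightarrow> (nat \<Rightarrow> real) \<Rightarrow> (nat \<Rightarrow> real) \<Rightarrow> nat \<Rightarrow> nat \<Rightarrow> real" where
  "capacitance N rp rm i j =
     - (boundary_flux (resonators N rp rm) (potential N rp rm j) (rp i)
        - boundary_flux (resonators N rp rm) (potential N rp rm j) (rm i))"

(* The quotient r_j^- r_{j+1}^+ / (r_j^- - r_{j+1}^+) for 0 \<le> j \<le> N, under the conventions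
   that r_0^- is read as +infinity (quotient r_1^+) and r_{N+1}^+ as 0 (quotient 0). *)
definition gap_quotient ::
  "nat \<Rightarrow> (nat \<Rightarrow> real) \<Rightarrow> (nat \<Rightarrow> real) \<Rightarrow> nat \<Rightarrow> real" where
  "gap_quotient N rp rm j =
     (if j = 0 then rp 1
      else if j = N then 0
      else rm j * rp (j + 1) / (rm j - rp (j + 1)))"

end

theory Submission
  imports Defs
begin

text \<open>
  The shells cut their complement into gaps numbered from the outside: gap 0 is the exterior of the
  whole structure, gap \<^term>\<open>k::nat\<close> lies between the shells \<open>k\<close> and \<open>k + 1\<close>, and gap \<open>N\<close> is the
  innermost ball. For \<open>k < N\<close> let \<open>U\<^sub>k\<close> be the continuous function that is 1 within the
  inner boundary sphere of the gap, 0 beyond the outer one, and of the form \<open>G\<^sub>k / |x| + B\<close> in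
  between, where \<open>G\<^sub>k\<close> is the gap quotient; let \<open>U\<^sub>N = 0\<close>.
  On shell \<open>i\<close> the function \<open>U\<^sub>k\<close> takes the value \<open>[k < i]\<close>. Hence \<open>U\<^bsub>j-1\<^esub> - U\<^sub>j\<close> is \<open>\<delta>\<^bsub>i,j\<^esub>\<close> on shell \<open>i\<close>, and
  since \<open>1 / |x|\<close> is harmonic away from the origin, it is a solution of the boundary value problem
  for \<open>V\<^sub>j\<close> (\<open>potential_eq_shell_potential\<close>). The innermost gap is the only one containing the
  origin, and there the solution is constant.

  The solution is unique by the maximum principle: the difference of two solutions vanishes on the
  shells and at infinity, so a positive value would produce an interior maximum. Adding a small
  multiple of \<open>|x|\<^sup>2\<close> makes the Laplacian strictly positive there, which contradicts the
  second-derivative test (\<open>harmonic_vanishing_outside_nonpos\<close>).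

  In gap \<open>m\<close> the solution is \<open>A\<^sub>m / |x| + B\<close>, where \<open>A\<^sub>m\<close> is \<open>G\<^bsub>j-1\<^esub>\<close> for \<open>m = j - 1\<close>, \<open>-G\<^sub>j\<close> for
  \<open>m = j\<close>, and 0 otherwise (\<open>gap_charge\<close>). The radial derivative \<open>-A\<^sub>m / r\<^sup>2\<close> is constant on each
  sphere, whose area is \<open>4 \<pi> r\<^sup>2\<close>, so the flux through either boundary sphere of gap \<open>m\<close> is
  \<open>-4 \<pi> A\<^sub>m\<close>. The outer sphere of shell \<open>i\<close> bounds gap \<open>i - 1\<close> and its inner sphere bounds gap \<open>i\<close>,
  whence the capacitance is \<open>4 \<pi> (A\<^bsub>i-1\<^esub> - A\<^sub>i)\<close>.
\<close>

section \<open>Partial derivatives and linear combinations\<close>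

lemma partial_deriv_eqI:
  assumes "(u has_derivative u') (at x)"
  shows "partial_deriv k u x = u' (axis k 1)"
proof -
  have lin: "linear u'"
    using assms has_derivative_linear by blast
  have "((\<lambda>t::real. x + t *\<^sub>R axis k 1) has_derivative (\<lambda>t. t *\<^sub>R axis k 1)) (at 0)"
    by (auto intro!: derivative_eq_intros)
  moreover have "(u has_derivative u') (at (x + 0 *\<^sub>R axis k 1))"
    using assms by simp
  ultimately have "((\<lambda>t. u (x + t *\<^sub>R axis k 1)) has_derivative (\<lambda>t. u' (t *\<^sub>R axis k 1))) (at 0)"
    by (rule has_derivative_compose)
  then have "((\<lambda>t. u (x + t *\<^sub>R axis k 1)) has_derivative (\<lambda>t. u' (axis k 1) * t)) (at 0)"
    by (simp add: linear_cmul[OF lin] mult.commute)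
  then show ?thesis
    unfolding partial_deriv_def has_field_derivative_def[symmetric] by (rule DERIV_imp_deriv)
qed

lemma partial_deriv_along_axis:
  assumes "u differentiable (at (x + t *\<^sub>R axis k 1))"
  shows "((\<lambda>s. u (x + s *\<^sub>R axis k 1)) has_real_derivative partial_deriv k u (x + t *\<^sub>R axis k 1)) (at t)"
proof -
  obtain u' where u': "(u has_derivative u') (at (x + t *\<^sub>R axis k 1))"
    using assms unfolding differentiable_def by blast
  have lin: "linear u'"
    using u' has_derivative_linear by blast
  have "((\<lambda>t::real. x + t *\<^sub>R axis k 1) has_derivative (\<lambda>t. t *\<^sub>R axis k 1)) (at t)"
    by (auto intro!: derivative_eq_intros)
  from has_derivative_compose[OF this u']
  have "((\<lambda>t. u (x + t *\<^sub>R axis k 1)) has_derivative (\<lambda>t. u' (axis k 1) * t)) (at t)"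
    by (simp add: linear_cmul[OF lin] mult.commute)
  then show ?thesis
    by (simp add: partial_deriv_eqI[OF u'] has_field_derivative_def)
qed

text \<open>
  A partial derivative depends only on the values near the point. This is what allows second
  derivatives to be computed from a formula for the first ones that holds on an open set only.
\<close>
lemma partial_deriv_cong_open:
  assumes "open S" "x \<in> S" "\<And>y. y \<in> S \<Longrightarrow> u y = v y"
  shows "partial_deriv k u x = partial_deriv k v x"
proof -
  have "((\<lambda>t::real. x + t *\<^sub>R axis k 1) \<longlongrightarrow> x + 0 *\<^sub>R axis k 1) (nhds 0)"
    by (intro tendsto_intros filterlim_ident)
  then have "\<forall>\<^sub>F t in nhds 0. x + t *\<^sub>R axis k 1 \<in> S"
    using assms(1,2) by (auto dest: topological_tendstoD)
  then have "\<forall>\<^sub>F t in nhds 0. u (x + t *\<^sub>R axis k 1) = v (x + t *\<^sub>R axis k 1)"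
    by (rule eventually_mono) (use assms(3) in auto)
  then show ?thesis
    unfolding partial_deriv_def by (rule deriv_cong_ev) simp
qed

lemma differentiable_cong_open:
  assumes "open S" "x \<in> S" "\<And>y. y \<in> S \<Longrightarrow> u y = v y" "v differentiable (at x)"
  shows "u differentiable (at x)"
proof -
  obtain v' where "(v has_derivative v') (at x)"
    using assms(4) by (auto simp: differentiable_def)
  then have "(u has_derivative v') (at x)"
    using assms(1-3) by (metis has_derivative_transform_within_open)
  then show ?thesis
    by (auto simp: differentiable_def)
qed

lemma partial_deriv_lincomb:
  assumes "u differentiable (at x)" "v differentiable (at x)"
  shows "partial_deriv k (\<lambda>y. a * u y + b * v y) x = a * partial_deriv k u x + b * partial_deriv k v x"
proof -
  obtain u' v' where d: "(u has_derivative u') (at x)" "(v has_derivative v') (at x)"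
    using assms unfolding differentiable_def by blast
  have "((\<lambda>y. a * u y + b * v y) has_derivative (\<lambda>h. a * u' h + b * v' h)) (at x)"
    by (intro derivative_intros d)
  from partial_deriv_eqI[OF this] show ?thesis
    by (simp add: partial_deriv_eqI[OF d(1)] partial_deriv_eqI[OF d(2)])
qed

lemma partial_deriv2_lincomb:
  assumes "open S" "x \<in> S" "C2_on S u" "C2_on S v"
  shows "partial_deriv l (partial_deriv k (\<lambda>y. a * u y + b * v y)) x
    = a * partial_deriv l (partial_deriv k u) x + b * partial_deriv l (partial_deriv k v) x"
proof -
  have "partial_deriv l (partial_deriv k (\<lambda>y. a * u y + b * v y)) x
      = partial_deriv l (\<lambda>y. a * partial_deriv k u y + b * partial_deriv k v y) x"
    by (rule partial_deriv_cong_open[OF assms(1,2)], rule partial_deriv_lincomb)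
       (use assms(3,4) in \<open>auto simp: C2_on_def\<close>)
  also have "\<dots> = a * partial_deriv l (partial_deriv k u) x + b * partial_deriv l (partial_deriv k v) x"
    by (rule partial_deriv_lincomb) (use assms(2-4) in \<open>auto simp: C2_on_def\<close>)
  finally show ?thesis .
qed

lemma C2_on_lincomb:
  assumes "open S" "C2_on S u" "C2_on S v"
  shows "C2_on S (\<lambda>y. a * u y + b * v y)"
  unfolding C2_on_def
proof (intro conjI ballI allI)
  fix x assume "x \<in> S"
  then show "(\<lambda>y. a * u y + b * v y) differentiable (at x)"
    using assms unfolding C2_on_def by (intro derivative_intros) auto
next
  fix k x assume x: "x \<in> S"
  have "(\<lambda>y. a * partial_deriv k u y + b * partial_deriv k v y) differentiable (at x)"
    using assms x unfolding C2_on_def by (intro derivative_intros) auto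
  then show "partial_deriv k (\<lambda>y. a * u y + b * v y) differentiable (at x)"
    by (rule differentiable_cong_open[OF assms(1) x, rotated], intro partial_deriv_lincomb)
       (use assms in \<open>auto simp: C2_on_def\<close>)
next
  fix k l
  have "continuous_on S (\<lambda>x. a * partial_deriv l (partial_deriv k u) x + b * partial_deriv l (partial_deriv k v) x)"
    using assms unfolding C2_on_def by (intro continuous_intros) auto
  then show "continuous_on S (partial_deriv l (partial_deriv k (\<lambda>y. a * u y + b * v y)))"
    using partial_deriv2_lincomb[OF assms(1) _ assms(2,3)] by (subst continuous_on_cong[OF refl]) auto
qed

lemma laplacian_lincomb:
  assumes "open S" "x \<in> S" "C2_on S u" "C2_on S v"
  shows "laplacian (\<lambda>y. a * u y + b * v y) x = a * laplacian u x + b * laplacian v x"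
  by (simp add: laplacian_def partial_deriv2_lincomb[OF assms] sum.distrib sum_distrib_left)

lemma harmonic_on_diff:
  assumes "open S" "harmonic_on S u" "harmonic_on S v"
  shows "harmonic_on S (\<lambda>x. u x - v x)"
  using assms C2_on_lincomb[of S u v 1 "-1"] laplacian_lincomb[of S _ u v 1 "-1"]
  by (simp add: harmonic_on_def)

lemma C2_on_cong:
  assumes "open S" "\<And>x. x \<in> S \<Longrightarrow> u x = v x" "C2_on S v"
  shows "C2_on S u"
proof -
  have 1: "partial_deriv k u x = partial_deriv k v x" if "x \<in> S" for k x
    by (rule partial_deriv_cong_open[OF assms(1) that assms(2)])
  have 2: "partial_deriv l (partial_deriv k u) x = partial_deriv l (partial_deriv k v) x"
    if "x \<in> S" for k l x
    by (rule partial_deriv_cong_open[OF assms(1) that 1])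
  show ?thesis
    unfolding C2_on_def
  proof (intro conjI ballI allI)
    fix x assume "x \<in> S"
    then show "u differentiable (at x)"
      using assms differentiable_cong_open[of S x u v] by (auto simp: C2_on_def)
  next
    fix k x assume x: "x \<in> S"
    then show "partial_deriv k u differentiable (at x)"
      using assms differentiable_cong_open[OF assms(1) x 1] by (auto simp: C2_on_def)
  next
    fix k l
    show "continuous_on S (partial_deriv l (partial_deriv k u))"
      using assms(3) by (subst continuous_on_cong[OF refl 2]) (auto simp: C2_on_def)
  qed
qed

lemma harmonic_on_cong:
  assumes "open S" "\<And>x. x \<in> S \<Longrightarrow> u x = v x" "harmonic_on S v"
  shows "harmonic_on S u"
proof -
  have "partial_deriv l (partial_deriv k u) x = partial_deriv l (partial_deriv k v) x"
    if "x \<in> S" for k l x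
    by (rule partial_deriv_cong_open[OF assms(1) that partial_deriv_cong_open[OF assms(1) _ assms(2)]])
  then show ?thesis
    using assms C2_on_cong[OF assms(1,2)] by (simp add: harmonic_on_def laplacian_def)
qed

text \<open>
  Harmonicity is a local property, so it may be checked gap by gap, with a different formula in
  each gap.
\<close>
lemma harmonic_on_local:
  assumes "\<And>x. x \<in> S \<Longrightarrow> \<exists>T. open T \<and> x \<in> T \<and> harmonic_on T u"
  shows "harmonic_on S u"
proof -
  have "continuous (at x within S) (partial_deriv l (partial_deriv k u))" if x: "x \<in> S" for x k l
  proof -
    obtain T where "open T" "x \<in> T" "harmonic_on T u"
      using assms[OF x] by blast
    then show ?thesis
      by (metis C2_on_def continuous_at_imp_continuous_at_within continuous_on_eq_continuous_at harmonic_on_def)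
  qed
  then have "continuous_on S (partial_deriv l (partial_deriv k u))" for k l
    by (simp add: continuous_on_eq_continuous_within)
  moreover have "u differentiable (at x) \<and> (\<forall>k. partial_deriv k u differentiable (at x)) \<and> - laplacian u x = 0"
    if x: "x \<in> S" for x
    using assms[OF x] unfolding harmonic_on_def C2_on_def by blast
  ultimately show ?thesis
    unfolding harmonic_on_def C2_on_def by blast
qed

lemma harmonic_on_subset:
  assumes "harmonic_on S u" "T \<subseteq> S"
  shows "harmonic_on T u"
  using assms continuous_on_subset unfolding harmonic_on_def C2_on_def by blast

section \<open>Maximum principle\<close>

text \<open>
  If the second derivative were positive, the first derivative, which vanishes at the maximum,
  would be positive just to the right of it, and the function would increase there.
\<close>
lemma second_derivative_nonpos_at_local_max:
  fixes g g' :: "real \<Rightarrow> real"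
  assumes d: "0 < d"
    and g: "\<And>t. \<bar>t\<bar> < d \<Longrightarrow> (g has_real_derivative g' t) (at t)"
    and g': "(g' has_real_derivative l) (at 0)"
    and max: "\<And>t. \<bar>t\<bar> < d \<Longrightarrow> g t \<le> g 0"
  shows "l \<le> 0"
proof (rule ccontr)
  assume "\<not> l \<le> 0"
  then have "0 < l" by simp
  have "g' 0 = 0"
    by (rule DERIV_local_max[OF g[of 0] d]) (use d max in auto)
  obtain e where e: "e > 0" "\<And>h. h > 0 \<Longrightarrow> h < e \<Longrightarrow> g' 0 < g' (0 + h)"
    using DERIV_pos_inc_right[OF g' \<open>0 < l\<close>] by auto
  define t where "t = min d e / 2"
  have t: "0 < t" "t < d" "t < e"
    using d e(1) by (auto simp: t_def min_def)
  have "g 0 < g t"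
  proof (rule DERIV_pos_imp_increasing_open[OF t(1)])
    fix s assume "0 < s" "s < t"
    then show "\<exists>y. (g has_real_derivative y) (at s) \<and> 0 < y"
      using g[of s] e(2)[of s] \<open>g' 0 = 0\<close> t by (intro exI[of _ "g' s"]) auto
  next
    show "continuous_on {0..t} g"
    proof (intro continuous_at_imp_continuous_on ballI)
      fix s assume "s \<in> {0..t}"
      then show "isCont g s"
        using t by (intro DERIV_isCont[OF g]) auto
    qed
  qed
  with max[of t] t show False by simp
qed

lemma laplacian_nonpos_at_local_max:
  assumes "open S" "x \<in> S" "C2_on S u" "\<And>y. y \<in> S \<Longrightarrow> u y \<le> u x"
  shows "laplacian u x \<le> 0"
  unfolding laplacian_def
proof (rule sum_nonpos)
  fix k
  obtain d where d: "d > 0" "ball x d \<subseteq> S"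
    using assms(1,2) openE by blast
  have in_S: "x + t *\<^sub>R axis k 1 \<in> S" if "\<bar>t\<bar> < d" for t
    using d that by (auto simp: dist_norm subset_iff)
  show "partial_deriv k (partial_deriv k u) x \<le> 0"
  proof (rule second_derivative_nonpos_at_local_max[OF d(1)])
    fix t :: real assume t: "\<bar>t\<bar> < d"
    show "((\<lambda>s. u (x + s *\<^sub>R axis k 1)) has_real_derivative partial_deriv k u (x + t *\<^sub>R axis k 1)) (at t)"
      by (rule partial_deriv_along_axis) (use in_S[OF t] assms(3) in \<open>auto simp: C2_on_def\<close>)
    show "u (x + t *\<^sub>R axis k 1) \<le> u (x + 0 *\<^sub>R axis k 1)"
      using assms(4) in_S[OF t] by simp
  next
    have "partial_deriv k u differentiable (at (x + 0 *\<^sub>R axis k 1))"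
      using assms(2,3) by (simp add: C2_on_def)
    from partial_deriv_along_axis[OF this]
    show "((\<lambda>t. partial_deriv k u (x + t *\<^sub>R axis k 1)) has_real_derivative partial_deriv k (partial_deriv k u) x) (at 0)"
      by simp
  qed
qed

lemma partial_deriv_norm_square:
  fixes x :: "real^'n::finite"
  shows "partial_deriv k (\<lambda>x. (norm x)\<^sup>2) x = 2 * x $ k"
proof -
  have "((\<lambda>x::real^'n. x \<bullet> x) has_derivative (\<lambda>h. x \<bullet> h + h \<bullet> x)) (at x)"
    by (intro derivative_intros)
  from partial_deriv_eqI[OF this] show ?thesis
    by (simp add: power2_norm_eq_inner inner_axis inner_axis')
qed

lemma partial_deriv2_norm_square:
  fixes x :: "real^'n::finite"
  shows "partial_deriv l (partial_deriv k (\<lambda>x. (norm x)\<^sup>2)) x = (if l = k then 2 else 0)"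
proof -
  have "((\<lambda>x::real^'n. 2 * x $ k) has_derivative (\<lambda>h. 2 * h $ k)) (at x)"
    by (intro derivative_intros bounded_linear.has_derivative[OF bounded_linear_vec_nth])
  from partial_deriv_eqI[OF this] show ?thesis
    by (simp add: partial_deriv_norm_square[abs_def] axis_def)
qed

lemma C2_on_norm_square: "C2_on S (\<lambda>x::real^'n::finite. (norm x)\<^sup>2)"
proof -
  have "(\<lambda>x::real^'n. (norm x)\<^sup>2) differentiable (at x)" for x
    unfolding power2_norm_eq_inner by (intro differentiable_inner differentiable_ident)
  moreover have "(\<lambda>x::real^'n. 2 * x $ k) differentiable (at x)" for x k
    by (intro derivative_intros bounded_linear_imp_differentiable bounded_linear_vec_nth)
  ultimately show ?thesis
    by (simp add: C2_on_def partial_deriv2_norm_square[abs_def])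
      (simp add: partial_deriv_norm_square[abs_def])
qed

lemma laplacian_norm_square: "laplacian (\<lambda>x::real^'n::finite. (norm x)\<^sup>2) x = 2 * CARD('n)"
  by (simp add: laplacian_def partial_deriv2_norm_square)

text \<open>
  The weak maximum principle. Suppose \<^term>\<open>w x = 2 * d\<close> with \<^term>\<open>d > 0\<close>. Outside some ball
  \<^term>\<open>w\<close> stays below \<^term>\<open>d\<close>, and so does \<^term>\<open>e * (norm y)\<^sup>2\<close> inside the ball for small
  \<^term>\<open>e\<close>. The maximum of \<^term>\<open>\<lambda>y. w y + e * (norm y)\<^sup>2\<close> over the ball is therefore attained at
  an interior point where \<^term>\<open>w\<close> is harmonic, but there the Laplacian is positive.
\<close>
lemma harmonic_vanishing_outside_nonpos:
  fixes w :: "real^'n::finite \<Rightarrow> real"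
  assumes S: "open S" and h: "harmonic_on S w" and cont: "continuous_on UNIV w"
    and zero: "\<And>x. x \<notin> S \<Longrightarrow> w x = 0" and decay: "(w \<longlongrightarrow> 0) at_infinity"
  shows "w x \<le> 0"
proof (rule ccontr)
  assume "\<not> w x \<le> 0"
  define d where "d = w x / 2"
  have d: "0 < d" "w x = 2 * d"
    using \<open>\<not> w x \<le> 0\<close> by (auto simp: d_def)
  have "\<forall>\<^sub>F y in at_infinity. w y < d"
    using order_tendstoD(2)[OF decay d(1)] .
  then obtain R0 where R0: "\<And>y. norm y \<ge> R0 \<Longrightarrow> w y < d"
    unfolding eventually_at_infinity by blast
  define R where "R = max R0 0"
  have R: "0 \<le> R" "\<And>y. norm y \<ge> R \<Longrightarrow> w y < d"
    using R0 by (auto simp: R_def)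
  \<comment> \<open>The summand 1 keeps the denominator positive and the next inequality strict.\<close>
  define e where "e = d / (R\<^sup>2 + 1)"
  have "e > 0"
    using d by (simp add: e_def add_nonneg_pos)
  have "e * R\<^sup>2 < d"
    using d(1) by (simp add: e_def pos_divide_less_eq add_nonneg_pos distrib_left)
  define v where "v = (\<lambda>y. 1 * w y + e * (norm y)\<^sup>2)"
  have "norm x < R"
    using R(2)[of x] d by linarith
  have "continuous_on (cball 0 R) v"
    unfolding v_def by (intro continuous_intros continuous_on_subset[OF cont]) auto
  moreover have "cball (0::real^'n) R \<noteq> {}"
    using R(1) by simp
  ultimately obtain y where y: "y \<in> cball 0 R" "\<And>z. z \<in> cball 0 R \<Longrightarrow> v z \<le> v y"
    using continuous_attains_sup[OF compact_cball] by metis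
  have "v y \<ge> v x"
    using \<open>norm x < R\<close> y(2) by simp
  moreover have "v x \<ge> 2 * d"
    using d \<open>e > 0\<close> by (simp add: v_def)
  ultimately have vy: "v y \<ge> 2 * d" by linarith
  have "(norm y)\<^sup>2 \<le> R\<^sup>2"
    using y(1) by (intro power_mono) auto
  then have "e * (norm y)\<^sup>2 < d"
    using \<open>e * R\<^sup>2 < d\<close> \<open>e > 0\<close> by (meson le_less_trans mult_le_cancel_left_pos)
  then have wy: "w y > d"
    using vy by (simp add: v_def)
  then have "y \<in> S"
    using zero[of y] d by auto
  moreover have "norm y < R"
    using wy R(2)[of y] by linarith
  ultimately have y_in: "y \<in> S \<inter> ball 0 R" by simp
  have C2: "C2_on S w"
    using h by (simp add: harmonic_on_def)
  have op: "open (S \<inter> ball 0 R)"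
    using S by auto
  have C2': "C2_on (S \<inter> ball 0 R) w"
    using C2 continuous_on_subset[of S _ "S \<inter> ball 0 R"] unfolding C2_on_def by blast
  have "laplacian v y \<le> 0"
    unfolding v_def
    by (rule laplacian_nonpos_at_local_max[OF op y_in C2_on_lincomb[OF op C2' C2_on_norm_square]])
       (use y(2) in \<open>simp add: v_def\<close>)
  moreover have "laplacian v y = e * (2 * CARD('n))"
    unfolding v_def laplacian_lincomb[OF S \<open>y \<in> S\<close> C2 C2_on_norm_square]
    using h \<open>y \<in> S\<close> by (simp add: laplacian_norm_square harmonic_on_def)
  ultimately show False
    using \<open>e > 0\<close> by (simp add: mult_le_0_iff)
qed

lemma bigo_inverse_norm_tendsto_0:
  fixes f :: "real^'n::finite \<Rightarrow> real"
  assumes "f \<in> O[at_infinity](\<lambda>x. 1 / norm x)"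
  shows "(f \<longlongrightarrow> 0) at_infinity"
proof -
  have "((\<lambda>x::real^'n. inverse (norm x)) \<longlongrightarrow> 0) at_infinity"
    by (rule tendsto_inverse_0_at_top[OF filterlim_norm_at_top])
  then have "(\<lambda>x::real^'n. 1 / norm x) \<in> o[at_infinity](\<lambda>_. 1)"
    by (intro smalloI_tendsto) (auto simp: divide_inverse)
  with assms have "f \<in> o[at_infinity](\<lambda>_. 1)"
    by (rule landau_o.big_small_trans)
  from smalloD_tendsto[OF this] show ?thesis by simp
qed

lemma closed_resonators: "closed (resonators N rp rm)"
  unfolding resonators_def shell_def
  by (intro closed_UN) (auto intro!: closed_Collect_conj closed_Collect_le continuous_intros)

text \<open>
  Since both functions may be exchanged, this inequality is the uniqueness of the potential.
\<close>
lemma is_potential_le: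
  assumes u: "is_potential N rp rm j u" and v: "is_potential N rp rm j v"
  shows "u x \<le> v x"
proof -
  have "u x - v x \<le> 0"
  proof (rule harmonic_vanishing_outside_nonpos[where S = "- resonators N rp rm"])
    show "open (- resonators N rp rm)"
      using closed_resonators by auto
    then show "harmonic_on (- resonators N rp rm) (\<lambda>x. u x - v x)"
      using u v by (intro harmonic_on_diff) (auto simp: is_potential_def)
    show "continuous_on UNIV (\<lambda>x. u x - v x)"
      using u v by (intro continuous_on_diff) (auto simp: is_potential_def)
    show "u x - v x = 0" if "x \<notin> - resonators N rp rm" for x
      using that u v by (auto simp: is_potential_def resonators_def)
    show "((\<lambda>x. u x - v x) \<longlongrightarrow> 0) at_infinity"
      using tendsto_diff[OF bigo_inverse_norm_tendsto_0 bigo_inverse_norm_tendsto_0, of u v] u v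
      by (auto simp: is_potential_def)
  qed
  then show ?thesis by simp
qed

lemma potential_eqI:
  assumes "is_potential N rp rm j V"
  shows "potential N rp rm j = V"
  unfolding potential_def
  using assms is_potential_le by (intro the_equality) (auto intro!: ext antisym)

section \<open>The Newtonian potential\<close>

lemma has_derivative_norm_power:
  fixes x :: "real^'n::finite"
  assumes "x \<noteq> 0"
  shows "((\<lambda>x. inverse (norm x ^ m)) has_derivative (\<lambda>h. - (real m) * (x \<bullet> h) / norm x ^ (m + 2))) (at x)"
proof (cases m)
  case 0
  then show ?thesis by simp
next
  case (Suc n)
  have "((\<lambda>x. inverse (norm x ^ m)) has_derivative
      (\<lambda>h. - (inverse (norm x ^ m) * (real m * (sgn x \<bullet> h) * norm x ^ (m - 1)) * inverse (norm x ^ m)))) (at x)"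
    using assms by (auto intro!: derivative_eq_intros has_derivative_norm simp: fun_eq_iff inner_commute)
  then show ?thesis
    by (rule has_derivative_eq_rhs)
       (use assms Suc in \<open>auto simp: fun_eq_iff sgn_div_norm divide_simps algebra_simps\<close>)
qed

lemma partial_deriv_newtonian:
  fixes x :: "real^'n::finite"
  assumes "x \<noteq> 0"
  shows "partial_deriv k (\<lambda>x. A / norm x + B) x = - A * x $ k * inverse (norm x ^ 3)"
proof -
  have "((\<lambda>x. A * inverse (norm x ^ 1) + B) has_derivative
      (\<lambda>h. A * (- (real 1) * (x \<bullet> h) / norm x ^ (1 + 2)) + 0)) (at x)"
    by (intro has_derivative_add has_derivative_mult_right has_derivative_const
      has_derivative_norm_power[OF assms])
  from partial_deriv_eqI[OF this] show ?thesis
    by (simp add: divide_inverse inner_axis power3_eq_cube)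
qed

lemma has_derivative_partial_newtonian:
  fixes x :: "real^'n::finite"
  assumes "x \<noteq> 0"
  shows "((\<lambda>x. - A * x $ k * inverse (norm x ^ 3)) has_derivative
    (\<lambda>h. - A * x $ k * (- 3 * (x \<bullet> h) / norm x ^ 5) + - A * h $ k * inverse (norm x ^ 3))) (at x)"
proof -
  have "((\<lambda>x. (- A * x $ k) * inverse (norm x ^ 3)) has_derivative
    (\<lambda>h. - A * x $ k * (- real 3 * (x \<bullet> h) / norm x ^ (3 + 2)) + (- A * h $ k) * inverse (norm x ^ 3))) (at x)"
    by (intro has_derivative_mult has_derivative_mult_right has_derivative_norm_power[OF assms]
       bounded_linear.has_derivative[OF bounded_linear_vec_nth] has_derivative_ident)
  then show ?thesis by simp
qed

lemma partial_deriv2_newtonian: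
  fixes x :: "real^'n::finite"
  assumes "x \<noteq> 0"
  shows "partial_deriv l (partial_deriv k (\<lambda>x. A / norm x + B)) x
    = 3 * A * x $ k * x $ l / norm x ^ 5 - (if l = k then A / norm x ^ 3 else 0)"
proof -
  have "partial_deriv l (partial_deriv k (\<lambda>x. A / norm x + B)) x
      = partial_deriv l (\<lambda>x. - A * x $ k * inverse (norm x ^ 3)) x"
    by (rule partial_deriv_cong_open[of "- {0}"]) (use assms partial_deriv_newtonian in auto)
  also have "\<dots> = 3 * A * x $ k * x $ l / norm x ^ 5 - (if l = k then A / norm x ^ 3 else 0)"
  proof -
    have "axis l (1::real) $ k = (if l = k then 1 else 0)"
      by (simp add: axis_def)
    then show ?thesis
      unfolding partial_deriv_eqI[OF has_derivative_partial_newtonian[OF assms]]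
      by (simp add: inner_axis divide_inverse)
  qed
  finally show ?thesis .
qed

text \<open>
  Dimension three enters here: the trace of the second derivatives of \<open>A / |x|\<close> is
  \<open>3 A |x|\<^sup>2 / |x|\<^sup>5 - n A / |x|\<^sup>3\<close>, where \<open>n\<close> is the dimension.
\<close>
lemma harmonic_on_newtonian: "harmonic_on (- {0}) (\<lambda>x::real^3. A / norm x + B)"
proof -
  have "laplacian (\<lambda>x::real^3. A / norm x + B) x = 0" if x: "x \<noteq> 0" for x
  proof -
    have "laplacian (\<lambda>x::real^3. A / norm x + B) x
        = (\<Sum>k\<in>UNIV. 3 * A / norm x ^ 5 * (x $ k)\<^sup>2 - A / norm x ^ 3)"
      by (simp add: laplacian_def partial_deriv2_newtonian[OF x] power2_eq_square mult_ac)
    also have "\<dots> = 3 * A / norm x ^ 5 * (norm x)\<^sup>2 - 3 * A / norm x ^ 3"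
      unfolding sum_subtractf sum_distrib_left[symmetric] norm_vec_def L2_set_def
      by (simp add: sum_nonneg)
    also have "\<dots> = 0"
      using x by (simp add: field_simps eval_nat_numeral)
    finally show ?thesis .
  qed
  moreover have "C2_on (- {0}) (\<lambda>x::real^3. A / norm x + B)"
    unfolding C2_on_def
  proof (intro conjI ballI allI)
    fix x :: "real^3" assume "x \<in> - {0}"
    then show "(\<lambda>x. A / norm x + B) differentiable (at x)"
      by (intro derivative_intros) auto
  next
    fix k and x :: "real^3" assume x: "x \<in> - {0}"
    then have "(\<lambda>x. - A * x $ k * inverse (norm x ^ 3)) differentiable (at x)"
      using has_derivative_partial_newtonian[of x A k] unfolding differentiable_def by blast
    then show "partial_deriv k (\<lambda>x. A / norm x + B) differentiable (at x)"
      by (rule differentiable_cong_open[of "- {0}", rotated 3]) (use x partial_deriv_newtonian in auto)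
  next
    fix k l
    have "continuous_on (- {0}) (\<lambda>x::real^3. 3 * A * x $ k * x $ l / norm x ^ 5 - (if l = k then A / norm x ^ 3 else 0))"
      by (cases "l = k") (auto intro!: continuous_intros)
    then show "continuous_on (- {0}) (partial_deriv l (partial_deriv k (\<lambda>x::real^3. A / norm x + B)))"
      by (subst continuous_on_cong[OF refl partial_deriv2_newtonian]) auto
  qed
  ultimately show ?thesis
    by (simp add: harmonic_on_def)
qed

lemma harmonic_on_const: "harmonic_on S (\<lambda>x::real^'n::finite. c)"
proof -
  have "partial_deriv k (\<lambda>x::real^'n. c) = (\<lambda>x. 0)" for k and c :: real
    by (simp add: partial_deriv_def fun_eq_iff)
  then show ?thesis
    by (simp add: harmonic_on_def C2_on_def laplacian_def)
qed

section \<open>Flux through a sphere\<close>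

lemma norm_spherical_point: "0 \<le> r \<Longrightarrow> norm (spherical_point r p) = r"
proof -
  assume r: "0 \<le> r"
  obtain a b where p: "p = (a, b)" by fastforce
  have "(norm (spherical_point r p))\<^sup>2 = r\<^sup>2 * (sin a)\<^sup>2 * ((cos b)\<^sup>2 + (sin b)\<^sup>2) + r\<^sup>2 * (cos a)\<^sup>2"
    unfolding power2_norm_eq_inner p spherical_point_def inner_vec_def sum_3 case_prod_conv vector_3 inner_real_def
    by algebra
  also have "\<dots> = r\<^sup>2 * ((sin a)\<^sup>2 + (cos a)\<^sup>2)"
    by (simp only: sin_cos_squared_add2[of b] distrib_left mult_1_right)
  also have "\<dots> = r\<^sup>2"
    by simp
  finally show ?thesis
    using r by (simp add: power2_eq_iff_nonneg)
qed

lemma borel_measurable_spherical_point: "spherical_point r \<in> borel_measurable borel"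
proof (rule borel_measurable_continuous_onI)
  have "spherical_point r = (\<lambda>p. \<chi> i. if i = 1 then r * sin (fst p) * cos (snd p)
      else if i = 2 then r * sin (fst p) * sin (snd p) else r * cos (fst p))"
    by (auto simp: fun_eq_iff spherical_point_def vec_eq_iff forall_3 vector_3)
  moreover have "continuous_on UNIV \<dots>"
  proof (rule continuous_on_vec_lambda)
    fix i :: 3
    show "continuous_on UNIV (\<lambda>p. if i = 1 then r * sin (fst p) * cos (snd p)
      else if i = 2 then r * sin (fst p) * sin (snd p) else r * cos (fst p))"
      by (cases "i = 1"; cases "i = 2") (auto intro!: continuous_intros)
  qed
  ultimately show "continuous_on UNIV (spherical_point r)"
    by simp
qed

text \<open>
  In spherical coordinates the whole parameter rectangle is mapped into the sphere, so its measure
  is the integral of the area element, evaluated as an iterated integral.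
\<close>
lemma emeasure_sphere_measure:
  assumes r: "0 \<le> r"
  shows "emeasure (sphere_measure r) (sphere 0 r) = ennreal (4 * pi * r\<^sup>2)"
proof -
  let ?f = "\<lambda>(\<theta>, \<phi>). ennreal (indicator ({0..pi} \<times> {0..2 * pi}) (\<theta>, \<phi>) * (r\<^sup>2 * sin \<theta>))"
  have f: "?f \<in> borel_measurable (borel :: (real \<times> real) measure)"
    unfolding borel_prod[symmetric] by measurable
  have pre: "spherical_point r -` sphere 0 r \<inter> space (density lborel ?f) = UNIV"
    using norm_spherical_point[OF r] by auto
  have "emeasure (sphere_measure r) (sphere 0 r) = emeasure (density lborel ?f) UNIV"
    unfolding sphere_measure_def pre[symmetric]
    by (rule emeasure_distr) (use borel_measurable_spherical_point in auto)
  also have "\<dots> = (\<integral>\<^sup>+ p. ?f p \<partial>lborel)"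
    using f by (subst emeasure_density) auto
  also have "\<dots> = (\<integral>\<^sup>+ p. ?f p \<partial>(lborel \<Otimes>\<^sub>M lborel))"
    by (simp add: lborel_prod)
  also have "\<dots> = (\<integral>\<^sup>+ \<theta>. \<integral>\<^sup>+ \<phi>. ?f (\<theta>, \<phi>) \<partial>lborel \<partial>lborel)"
    using f by (intro lborel.nn_integral_fst[symmetric]) (simp add: lborel_prod)
  also have "\<dots> = (\<integral>\<^sup>+ \<theta>. ennreal (2 * pi * r\<^sup>2 * sin \<theta>) * indicator {0..pi} \<theta> \<partial>lborel)"
  proof (rule nn_integral_cong)
    fix \<theta> :: real
    show "(\<integral>\<^sup>+ \<phi>. ?f (\<theta>, \<phi>) \<partial>lborel) = ennreal (2 * pi * r\<^sup>2 * sin \<theta>) * indicator {0..pi} \<theta>"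
    proof (cases "\<theta> \<in> {0..pi}")
      case True
      then have s: "0 \<le> sin \<theta>" by (simp add: sin_ge_zero)
      have "(\<integral>\<^sup>+ \<phi>. ?f (\<theta>, \<phi>) \<partial>lborel)
          = (\<integral>\<^sup>+ \<phi>. ennreal (r\<^sup>2 * sin \<theta>) * indicator {0..2 * pi} \<phi> \<partial>lborel)"
        using True by (intro nn_integral_cong) (auto simp: indicator_def)
      also have "\<dots> = ennreal (r\<^sup>2 * sin \<theta>) * ennreal (2 * pi)"
        by (simp add: nn_integral_cmult_indicator)
      also have "\<dots> = ennreal (2 * pi * r\<^sup>2 * sin \<theta>)"
        using s by (subst ennreal_mult[symmetric]) (auto simp: mult_ac)
      finally show ?thesis using True by simp
    next
      case False
      then have "?f (\<theta>, \<phi>) = 0" for \<phi>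
        by (auto simp: indicator_def)
      then show ?thesis
        using False by simp
    qed
  qed
  also have "\<dots> = ennreal (- 2 * pi * r\<^sup>2 * cos pi - (- 2 * pi * r\<^sup>2 * cos 0))"
  proof (rule nn_integral_FTC_Icc)
    fix t :: real assume "t \<in> {0..pi}"
    show "((\<lambda>t. - 2 * pi * r\<^sup>2 * cos t) has_real_derivative 2 * pi * r\<^sup>2 * sin t) (at t)"
      by (auto intro!: derivative_eq_intros)
    show "0 \<le> 2 * pi * r\<^sup>2 * sin t"
      using \<open>t \<in> {0..pi}\<close> by (simp add: sin_ge_zero)
  qed auto
  also have "\<dots> = ennreal (4 * pi * r\<^sup>2)"
    by simp
  finally show ?thesis .
qed

lemma boundary_flux_const:
  assumes r: "0 \<le> r" and c: "\<And>x. norm x = r \<Longrightarrow> normal_derivative D u x = c"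
  shows "boundary_flux D u r = 4 * pi * r\<^sup>2 * c"
proof -
  have "boundary_flux D u r = (LINT x|sphere_measure r. indicat_real (sphere 0 r) x *\<^sub>R c)"
    unfolding boundary_flux_def set_lebesgue_integral_def
    by (rule Bochner_Integration.integral_cong) (auto simp: indicator_def c)
  also have "\<dots> = measure (sphere_measure r) (sphere 0 r) *\<^sub>R c"
    using emeasure_sphere_measure[OF r]
    by (subst integral_scaleR_left) (auto simp: sphere_measure_def intro!: integrable_real_indicator)
  also have "\<dots> = 4 * pi * r\<^sup>2 * c"
    using emeasure_sphere_measure[OF r] by (simp add: measure_def)
  finally show ?thesis .
qed

text \<open>
  The bound on \<^term>\<open>t\<close> says that the shifted point does not lie beyond the origin.
\<close>
lemma norm_radial_shift:
  fixes x :: "'a::real_normed_vector"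
  assumes "x \<noteq> 0" "- norm x \<le> t"
  shows "norm (x + t *\<^sub>R (x /\<^sub>R norm x)) = norm x + t"
proof -
  have "x + t *\<^sub>R (x /\<^sub>R norm x) = (1 + t / norm x) *\<^sub>R x"
    by (simp add: algebra_simps divide_inverse)
  moreover have "0 \<le> 1 + t / norm x"
    using assms by (simp add: field_simps)
  ultimately have "norm (x + t *\<^sub>R (x /\<^sub>R norm x)) = (1 + t / norm x) * norm x"
    by simp
  also have "\<dots> = norm x + t"
    using assms by (simp add: distrib_right)
  finally show ?thesis .
qed

text \<open>
  From the boundary point \<^term>\<open>x\<close> the ray leaves \<^term>\<open>D\<close> in the direction given by the
  sign \<^term>\<open>\<sigma>\<close> and stays inside \<^term>\<open>D\<close> in the opposite one, so the derivative from the
  complement is one-sided and sees only the profile \<^term>\<open>A / r + B\<close>.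
\<close>
lemma normal_derivative_newtonian:
  assumes x: "x \<noteq> 0" and d: "0 < d" and \<sigma>: "\<sigma> = 1 \<or> \<sigma> = -1"
    and inner: "\<And>s. 0 \<le> s \<Longrightarrow> s < d \<Longrightarrow> x + (- \<sigma> * s) *\<^sub>R (x /\<^sub>R norm x) \<in> D"
    and outer: "\<And>s. 0 < s \<Longrightarrow> s < d \<Longrightarrow> x + (\<sigma> * s) *\<^sub>R (x /\<^sub>R norm x) \<notin> D"
    and u: "\<And>s. 0 \<le> s \<Longrightarrow> s < d \<Longrightarrow>
      u (x + (\<sigma> * s) *\<^sub>R (x /\<^sub>R norm x)) = A / (norm x + \<sigma> * s) + B"
  shows "normal_derivative D u x = - A / (norm x)\<^sup>2"
proof -
  let ?S = "{t. x + t *\<^sub>R (x /\<^sub>R norm x) \<notin> D}"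
  have "0 islimpt ?S"
    unfolding islimpt_approachable_real
  proof (intro allI impI)
    fix e :: real assume "0 < e"
    define s where "s = min d e / 2"
    have s: "0 < s" "s < d" "s < e"
      using d \<open>0 < e\<close> by (auto simp: s_def min_def)
    then have "\<sigma> * s \<in> ?S"
      using outer by blast
    then show "\<exists>t\<in>?S. t \<noteq> 0 \<and> \<bar>t - 0\<bar> < e"
      using s \<sigma> by (intro bexI[of _ "\<sigma> * s"]) (auto simp: abs_mult)
  qed
  then have nontriv: "at 0 within ?S \<noteq> bot"
    by (simp add: trivial_limit_within)
  have "u (x + t *\<^sub>R (x /\<^sub>R norm x)) = A / (norm x + t) + B" if "t \<in> ?S" "\<bar>t\<bar> < d" for t
  proof -
    have t: "\<sigma> * (\<sigma> * t) = t"
      using \<sigma> by auto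
    have "0 < \<sigma> * t"
    proof (rule ccontr)
      assume "\<not> 0 < \<sigma> * t"
      then have "x + (- \<sigma> * (- (\<sigma> * t))) *\<^sub>R (x /\<^sub>R norm x) \<in> D"
        using \<open>\<bar>t\<bar> < d\<close> \<sigma> by (intro inner) auto
      then show False
        using \<open>t \<in> ?S\<close> t by simp
    qed
    then show ?thesis
      using u[of "\<sigma> * t"] t \<open>\<bar>t\<bar> < d\<close> \<sigma> by auto
  qed
  then have ev: "\<forall>\<^sub>F t in at 0 within ?S. u (x + t *\<^sub>R (x /\<^sub>R norm x)) = A / (norm x + t) + B"
    unfolding eventually_at using d by (intro exI[of _ d]) (auto simp: dist_real_def)
  have "((\<lambda>t. A / (norm x + t) + B) has_real_derivative - A / (norm x)\<^sup>2) (at 0 within ?S)"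
    using x by (auto intro!: derivative_eq_intros simp: power2_eq_square)
  then have "((\<lambda>t. u (x + t *\<^sub>R (x /\<^sub>R norm x))) has_real_derivative - A / (norm x)\<^sup>2) (at 0 within ?S)"
    using u[of 0] d by (subst has_field_derivative_cong_eventually[OF ev]) simp_all
  then show ?thesis
    unfolding normal_derivative_def has_real_derivative_iff_has_vector_derivative
    using vector_derivative_within[OF nontriv] by blast
qed

section \<open>The potentials of nested shells\<close>

locale nested_shells =
  fixes N :: nat and rp rm :: "nat \<Rightarrow> real"
  assumes N_pos: "1 \<le> N"
    and rm_less_rp: "\<And>j. j \<in> {1..N} \<Longrightarrow> rm j < rp j"
    and rp_Suc_less_rm: "\<And>j. j \<in> {1..<N} \<Longrightarrow> rp (j + 1) < rm j"
    and rm_last_pos: "0 < rm N"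
begin

abbreviation "G \<equiv> gap_quotient N rp rm"

lemma rm_antimono:
  assumes "1 \<le> i" "i \<le> k" "k \<le> N"
  shows "rm k \<le> rm i"
  using assms(2,3)
proof (induction k rule: dec_induct)
  case (step n)
  then show ?case
    using rp_Suc_less_rm[of n] rm_less_rp[of "Suc n"] assms(1) by force
qed simp

lemma rp_antimono:
  assumes "1 \<le> i" "i \<le> k" "k \<le> N"
  shows "rp k \<le> rp i"
  using assms(2,3)
proof (induction k rule: dec_induct)
  case (step n)
  then show ?case
    using rp_Suc_less_rm[of n] rm_less_rp[of n] assms(1) by force
qed simp

lemma rm_pos: "1 \<le> k \<Longrightarrow> k \<le> N \<Longrightarrow> 0 < rm k"
  using rm_antimono[of k N] rm_last_pos by simp

lemma rp_pos: "1 \<le> k \<Longrightarrow> k \<le> N \<Longrightarrow> 0 < rp k"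
  using rm_pos[of k] rm_less_rp[of k] by simp

text \<open>
  The gaps with their boundary spheres. The conventions of an infinite inner radius of shell 0 and
  a zero outer radius of shell \<open>N + 1\<close> appear as missing constraints.
\<close>
definition in_gap :: "nat \<Rightarrow> real \<Rightarrow> bool" where
  "in_gap m r \<longleftrightarrow> (m < N \<longrightarrow> rp (m + 1) \<le> r) \<and> (0 < m \<longrightarrow> r \<le> rm m)"

definition open_gap :: "nat \<Rightarrow> (real^3) set" where
  "open_gap m = {x. (m < N \<longrightarrow> rp (m + 1) < norm x) \<and> (0 < m \<longrightarrow> norm x < rm m)}"

text \<open>
  The function \<open>U\<^sub>k\<close> of the introduction. Clamping \<^term>\<open>norm x\<close> from below makes it constant inside
  the gap and avoids the singularity at the origin; the maximum with 0 cuts it off outside. The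
  subtracted constant is the value of \<open>1 / |x|\<close> at the outer boundary of the gap, which is 0 for
  the exterior gap.
\<close>
definition gap_ramp :: "nat \<Rightarrow> real^3 \<Rightarrow> real" where
  "gap_ramp k x = G k * max 0 (1 / max (norm x) (rp (k + 1)) - (if k = 0 then 0 else 1 / rm k))"

definition shell_potential :: "nat \<Rightarrow> real^3 \<Rightarrow> real" where
  "shell_potential j x = gap_ramp (j - 1) x - gap_ramp j x"

lemma open_gap: "open (open_gap m)"
  unfolding open_gap_def
  by (cases "m < N"; cases "0 < m") (auto intro!: open_Collect_conj open_Collect_less continuous_intros)

lemma in_gap_if_open_gap: "x \<in> open_gap m \<Longrightarrow> in_gap m (norm x)"
  by (auto simp: open_gap_def in_gap_def)

text \<open>
  The gap quotient is \<open>1 / (1 / a - 1 / b)\<close> for a gap with inner radius \<open>a\<close> and outer radius \<open>b\<close>,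
  which is the factor that normalises the ramp to 1.
\<close>
lemma gap_ramp_inside:
  assumes "k < N" "norm x \<le> rp (k + 1)"
  shows "gap_ramp k x = 1"
proof -
  have a: "0 < rp (k + 1)"
    using assms rp_pos[of "k + 1"] by simp
  show ?thesis
  proof (cases "k = 0")
    case True
    then show ?thesis
      using assms a by (simp add: gap_ramp_def gap_quotient_def)
  next
    case False
    then have b: "rp (k + 1) < rm k"
      using rp_Suc_less_rm[of k] assms by simp
    then have "1 / rm k < 1 / rp (k + 1)"
      using a by (simp add: field_simps)
    then show ?thesis
      using assms a b False by (simp add: gap_ramp_def gap_quotient_def field_simps)
  qed
qed

lemma gap_ramp_outside:
  assumes "1 \<le> k" "k \<le> N" "rm k \<le> norm x"
  shows "gap_ramp k x = 0"
proof -
  have "0 < rm k"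
    using assms rm_pos by simp
  then have "1 / max (norm x) (rp (k + 1)) \<le> 1 / rm k"
    using assms by (intro divide_left_mono) (auto simp: max_def zero_less_mult_iff)
  then show ?thesis
    using assms by (simp add: gap_ramp_def)
qed

lemma gap_ramp_between:
  assumes "k < N" "in_gap k (norm x)"
  shows "gap_ramp k x = G k / norm x - (if k = 0 then 0 else G k / rm k)"
proof -
  have "0 < norm x"
    using assms rp_pos[of "k + 1"] by (force simp: in_gap_def)
  moreover have "1 / rm k \<le> 1 / norm x" if "0 < k"
    using assms \<open>0 < norm x\<close> that by (intro divide_left_mono mult_pos_pos rm_pos) (auto simp: in_gap_def)
  ultimately show ?thesis
    using assms by (auto simp: gap_ramp_def in_gap_def max_def right_diff_distrib)
qed

lemma gap_ramp_on_gap: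
  assumes "k \<le> N" "m \<le> N"
  shows "\<exists>B. \<forall>x. in_gap m (norm x) \<longrightarrow> gap_ramp k x = (if m = k then G k else 0) / norm x + B"
proof (cases m k rule: linorder_cases)
  case less
  have "gap_ramp k x = 0" if "in_gap m (norm x)" for x
  proof (rule gap_ramp_outside)
    have "rm k \<le> rm (m + 1)"
      using less assms by (intro rm_antimono) auto
    also have "\<dots> < rp (m + 1)"
      using less assms by (intro rm_less_rp) auto
    also have "\<dots> \<le> norm x"
      using less assms that by (simp add: in_gap_def)
    finally show "rm k \<le> norm x" by simp
  qed (use less assms in auto)
  then show ?thesis
    using less by auto
next
  case equal
  show ?thesis
  proof (cases "k = N")
    case True
    then have "G k = 0"
      using N_pos by (simp add: gap_quotient_def)
    then show ?thesis
      using equal by (intro exI[of _ 0]) (simp add: gap_ramp_def)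
  next
    case False
    then show ?thesis
      using equal assms gap_ramp_between[of k]
      by (intro exI[of _ "- (if k = 0 then 0 else G k / rm k)"]) auto
  qed
next
  case greater
  have "gap_ramp k x = 1" if "in_gap m (norm x)" for x
  proof (rule gap_ramp_inside)
    have "norm x \<le> rm m"
      using greater that by (simp add: in_gap_def)
    also have "\<dots> < rp m"
      using greater assms by (intro rm_less_rp) auto
    also have "\<dots> \<le> rp (k + 1)"
      using greater assms by (intro rp_antimono) auto
    finally show "norm x \<le> rp (k + 1)" by simp
  qed (use greater assms in auto)
  then show ?thesis
    using greater by auto
qed

text \<open>
  The coefficient of \<open>1 / |x|\<close> in gap \<^term>\<open>m\<close> of the potential of shell \<^term>\<open>j\<close>; up to the
  factor \<open>4 \<pi>\<close> it is the charge enclosed by a sphere in that gap.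
\<close>
definition gap_charge :: "nat \<Rightarrow> nat \<Rightarrow> real" where
  "gap_charge j m = G m * (of_bool (m = j - 1) - of_bool (m = j))"

lemma shell_potential_on_gap:
  assumes "1 \<le> j" "j \<le> N" "m \<le> N"
  shows "\<exists>B. \<forall>x. in_gap m (norm x) \<longrightarrow> shell_potential j x = gap_charge j m / norm x + B"
proof -
  obtain B1 where B1: "\<And>x. in_gap m (norm x) \<Longrightarrow>
      gap_ramp (j - 1) x = (if m = j - 1 then G (j - 1) else 0) / norm x + B1"
    using gap_ramp_on_gap[of "j - 1" m] assms(2,3) by fastforce
  obtain B2 where B2: "\<And>x. in_gap m (norm x) \<Longrightarrow>
      gap_ramp j x = (if m = j then G j else 0) / norm x + B2"
    using gap_ramp_on_gap[of j m] assms by auto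
  have "shell_potential j x = gap_charge j m / norm x + (B1 - B2)" if "in_gap m (norm x)" for x
    unfolding shell_potential_def gap_charge_def B1[OF that] B2[OF that]
    using assms by (simp add: diff_divide_distrib)
  then show ?thesis by blast
qed

lemma outside_resonators_in_open_gap:
  assumes "x \<notin> resonators N rp rm"
  shows "\<exists>m\<le>N. x \<in> open_gap m"
proof -
  \<comment> \<open>The gap sought is the last one whose outer radius exceeds \<^term>\<open>norm x\<close>.\<close>
  define P where "P = (\<lambda>m. m \<le> N \<and> (0 < m \<longrightarrow> norm x < rm m))"
  have "P 0" by (simp add: P_def)
  then have "\<exists>m. P m \<and> (\<forall>n. P n \<longrightarrow> n \<le> m)"
    using ex_has_greatest_nat[of P 0 id "Suc N"] by (auto simp: P_def)
  then obtain m where m: "P m" "\<And>n. P n \<Longrightarrow> n \<le> m" by blast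
  have "rp (m + 1) < norm x" if "m < N"
  proof (rule ccontr)
    assume "\<not> rp (m + 1) < norm x"
    moreover have "\<not> P (m + 1)"
      using m(2)[of "m + 1"] by auto
    then have "rm (m + 1) \<le> norm x"
      using that by (auto simp: P_def)
    ultimately show False
      using assms that by (auto simp: resonators_def shell_def)
  qed
  then show ?thesis
    using m(1) by (auto simp: P_def open_gap_def)
qed

lemma continuous_gap_ramp:
  assumes "k \<le> N"
  shows "continuous_on UNIV (gap_ramp k)"
proof (cases "k = N")
  case True
  then have "gap_ramp k = (\<lambda>x. 0)"
    using N_pos by (auto simp: gap_ramp_def gap_quotient_def)
  then show ?thesis by simp
next
  case False
  then have "0 < rp (k + 1)"
    using assms rp_pos[of "k + 1"] by simp
  then show ?thesis
    unfolding gap_ramp_def[abs_def] by (intro continuous_intros) (auto simp: max_def)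
qed

lemma harmonic_shell_potential:
  assumes j: "1 \<le> j" "j \<le> N"
  shows "harmonic_on (- resonators N rp rm) (shell_potential j)"
proof (rule harmonic_on_local)
  fix x assume "x \<in> - resonators N rp rm"
  then obtain m where m: "m \<le> N" "x \<in> open_gap m"
    using outside_resonators_in_open_gap by auto
  obtain B where B: "\<And>x. in_gap m (norm x) \<Longrightarrow> shell_potential j x = gap_charge j m / norm x + B"
    using shell_potential_on_gap[OF j m(1)] by blast
  have "harmonic_on (open_gap m) (\<lambda>x. gap_charge j m / norm x + B)"
  proof (cases "m = N")
    case True
    \<comment> \<open>The innermost gap contains the origin, but carries no charge.\<close>
    then have "gap_charge j m = 0"
      using N_pos by (simp add: gap_charge_def gap_quotient_def)
    then show ?thesis
      using harmonic_on_const by simp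
  next
    case False
    then have "open_gap m \<subseteq> - {0}"
      using m(1) rp_pos[of "m + 1"] by (auto simp: open_gap_def)
    then show ?thesis
      by (rule harmonic_on_subset[OF harmonic_on_newtonian])
  qed
  then have "harmonic_on (open_gap m) (shell_potential j)"
    by (rule harmonic_on_cong[OF open_gap, rotated]) (rule B[OF in_gap_if_open_gap])
  then show "\<exists>T. open T \<and> x \<in> T \<and> harmonic_on T (shell_potential j)"
    using open_gap m(2) by blast
qed

lemma gap_ramp_on_shell:
  assumes "k \<le> N" "i \<in> {1..N}" "x \<in> shell rp rm i"
  shows "gap_ramp k x = of_bool (k < i)"
proof (cases "k < i")
  case True
  have "norm x \<le> rp (k + 1)"
    using assms True rp_antimono[of "k + 1" i] by (auto simp: shell_def)
  then show ?thesis
    using True assms by (simp add: gap_ramp_inside)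
next
  case False
  have "rm k \<le> norm x"
    using assms False rm_antimono[of i k] by (auto simp: shell_def)
  then show ?thesis
    using False assms by (simp add: gap_ramp_outside)
qed

text \<open>
  Outside the structure only the ramp of the exterior gap is nonzero, and it is \<open>G\<^sub>0 / |x|\<close>.
\<close>
lemma shell_potential_decay:
  assumes j: "1 \<le> j" "j \<le> N"
  shows "shell_potential j \<in> O[at_infinity](\<lambda>x. 1 / norm x)"
proof -
  have dec: "gap_ramp k x = (if k = 0 then G 0 else 0) / norm x"
    if k: "k \<le> N" and x: "rp 1 \<le> norm x" for k x
  proof (cases "k = 0")
    case True
    then show ?thesis
      using gap_ramp_between[of 0 x] N_pos x by (simp add: in_gap_def)
  next
    case False
    then have "rm k \<le> norm x"
      using k x rm_antimono[of 1 k] rm_less_rp[of 1] N_pos by force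
    then show ?thesis
      using False k by (simp add: gap_ramp_outside)
  qed
  have "\<forall>\<^sub>F x in at_infinity. norm (shell_potential j x) \<le> \<bar>G 0\<bar> * norm (1 / norm x)"
    unfolding eventually_at_infinity
  proof (intro exI[of _ "rp 1"] allI impI)
    fix x :: "real^3" assume "rp 1 \<le> norm x"
    then show "norm (shell_potential j x) \<le> \<bar>G 0\<bar> * norm (1 / norm x)"
      using j dec[of "j - 1" x] dec[of j x] by (auto simp: shell_potential_def)
  qed
  then show ?thesis
    by (rule bigoI)
qed

lemma potential_eq_shell_potential:
  assumes j: "1 \<le> j" "j \<le> N"
  shows "potential N rp rm j = shell_potential j"
proof (rule potential_eqI)
  have "continuous_on UNIV (shell_potential j)"
    unfolding shell_potential_def[abs_def]
    using j by (intro continuous_on_diff continuous_gap_ramp) auto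
  moreover have "shell_potential j x = (if i = j then 1 else 0)"
    if "i \<in> {1..N}" "x \<in> shell rp rm i" for i x
    using gap_ramp_on_shell[OF _ that, of "j - 1"] gap_ramp_on_shell[OF _ that, of j] j that(1)
    by (auto simp: shell_potential_def)
  ultimately show "is_potential N rp rm j (shell_potential j)"
    unfolding is_potential_def
    using harmonic_shell_potential[OF j] shell_potential_decay[OF j] by blast
qed

section \<open>Fluxes and the capacitance matrix\<close>

lemma in_gap_not_in_resonators:
  assumes "x \<in> open_gap m" "m \<le> N"
  shows "x \<notin> resonators N rp rm"
proof
  assume "x \<in> resonators N rp rm"
  then obtain i where i: "i \<in> {1..N}" "rm i \<le> norm x" "norm x \<le> rp i"
    by (auto simp: resonators_def shell_def)
  show False
  proof (cases "i \<le> m")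
    case True
    then show False
      using i assms rm_antimono[of i m] by (auto simp: open_gap_def)
  next
    case False
    then show False
      using i assms rp_antimono[of "m + 1" i] by (auto simp: open_gap_def)
  qed
qed

text \<open>
  Here the complement lies in the direction of increasing radius, in gap \<open>i - 1\<close>. For \<open>i = 1\<close> that
  gap is unbounded.
\<close>
lemma flux_outer:
  assumes i: "i \<in> {1..N}" and j: "1 \<le> j" "j \<le> N"
  shows "boundary_flux (resonators N rp rm) (shell_potential j) (rp i) = - 4 * pi * gap_charge j (i - 1)"
proof -
  have pos: "0 < rp i" "0 < rm i" "rm i < rp i"
    using i rp_pos rm_pos rm_less_rp by auto
  obtain B where B: "\<And>x. in_gap (i - 1) (norm x) \<Longrightarrow> shell_potential j x = gap_charge j (i - 1) / norm x + B"
    using shell_potential_on_gap[OF j, of "(i - 1)"] i by fastforce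
  \<comment> \<open>Within distance \<open>d\<close> the ray meets neither the far side of the shell nor that of the gap;
    for the unbounded gap any positive bound, such as 1, will do.\<close>
  define d where "d = min (rp i - rm i) (if i = 1 then 1 else rm (i - 1) - rp i)"
  have "rp i < rm (i - 1)" if "i \<noteq> 1"
    using rp_Suc_less_rm[of "i - 1"] i that by fastforce
  then have d: "0 < d"
    using pos by (simp add: d_def)
  have dgap: "d \<le> rp i" "i \<noteq> 1 \<Longrightarrow> d \<le> rm (i - 1) - rp i"
    using pos by (auto simp: d_def)
  have "normal_derivative (resonators N rp rm) (shell_potential j) x = - gap_charge j (i - 1) / (rp i)\<^sup>2"
    if x: "norm x = rp i" for x
  proof -
    let ?y = "\<lambda>t. x + t *\<^sub>R (x /\<^sub>R norm x)"
    have "x \<noteq> 0"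
      using x pos by auto
    have n: "norm (?y t) = rp i + t" if "- rp i \<le> t" for t
      using norm_radial_shift[OF \<open>x \<noteq> 0\<close>, of t] that x by simp
    have "normal_derivative (resonators N rp rm) (shell_potential j) x = - gap_charge j (i - 1) / (norm x)\<^sup>2"
    proof (rule normal_derivative_newtonian[OF \<open>x \<noteq> 0\<close> d, of "1"])
      fix s assume s: "0 \<le> s" "s < d"
      show "?y (- (1) * s) \<in> resonators N rp rm"
        using s n[of "- (1) * s"] pos i
        by (auto simp: resonators_def shell_def d_def intro!: bexI[of _ i])
      have "in_gap (i - 1) (norm (?y ((1) * s)))"
        using s n[of "(1) * s"] pos i dgap by (auto simp: in_gap_def)
      from B[OF this] show "shell_potential j (?y ((1) * s)) = gap_charge j (i - 1) / (norm x + (1) * s) + B"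
        using s n[of "(1) * s"] x pos dgap by simp
    next
      fix s assume s: "0 < s" "s < d"
      then have "?y ((1) * s) \<in> open_gap (i - 1)"
        using n[of "(1) * s"] pos i dgap by (auto simp: open_gap_def)
      then show "?y ((1) * s) \<notin> resonators N rp rm"
        using i by (intro in_gap_not_in_resonators[of _ "(i - 1)"]) auto
    qed simp
    then show ?thesis
      by (simp add: x)
  qed
  then show ?thesis
    using boundary_flux_const[of "rp i"] pos by simp
qed

text \<open>
  Here the complement lies in the direction of decreasing radius, in gap \<open>i\<close>. For \<open>i = N\<close> that gap
  is a ball, and the ray must stop before the origin.
\<close>
lemma flux_inner:
  assumes i: "i \<in> {1..N}" and j: "1 \<le> j" "j \<le> N"
  shows "boundary_flux (resonators N rp rm) (shell_potential j) (rm i) = - 4 * pi * gap_charge j i"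
proof -
  have pos: "0 < rp i" "0 < rm i" "rm i < rp i"
    using i rp_pos rm_pos rm_less_rp by auto
  obtain B where B: "\<And>x. in_gap i (norm x) \<Longrightarrow> shell_potential j x = gap_charge j i / norm x + B"
    using shell_potential_on_gap[OF j, of "i"] i by fastforce
  define d where "d = min (rp i - rm i) (if i = N then rm i else rm i - rp (i + 1))"
  have d: "0 < d"
    using pos rp_Suc_less_rm[of i] i by (auto simp: d_def)
  have dgap: "d \<le> rm i" "i \<noteq> N \<Longrightarrow> d \<le> rm i - rp (i + 1)"
    using pos i rp_pos[of "i + 1"] by (auto simp: d_def)
  have "normal_derivative (resonators N rp rm) (shell_potential j) x = - gap_charge j i / (rm i)\<^sup>2"
    if x: "norm x = rm i" for x
  proof -
    let ?y = "\<lambda>t. x + t *\<^sub>R (x /\<^sub>R norm x)"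
    have "x \<noteq> 0"
      using x pos by auto
    have n: "norm (?y t) = rm i + t" if "- rm i \<le> t" for t
      using norm_radial_shift[OF \<open>x \<noteq> 0\<close>, of t] that x by simp
    have "normal_derivative (resonators N rp rm) (shell_potential j) x = - gap_charge j i / (norm x)\<^sup>2"
    proof (rule normal_derivative_newtonian[OF \<open>x \<noteq> 0\<close> d, of "-1"])
      fix s assume s: "0 \<le> s" "s < d"
      show "?y (- (-1) * s) \<in> resonators N rp rm"
        using s n[of "- (-1) * s"] pos i
        by (auto simp: resonators_def shell_def d_def intro!: bexI[of _ i])
      have "in_gap i (norm (?y ((-1) * s)))"
        using s n[of "(-1) * s"] pos i dgap by (auto simp: in_gap_def)
      from B[OF this] show "shell_potential j (?y ((-1) * s)) = gap_charge j i / (norm x + (-1) * s) + B"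
        using s n[of "(-1) * s"] x pos dgap by simp
    next
      fix s assume s: "0 < s" "s < d"
      then have "?y ((-1) * s) \<in> open_gap i"
        using n[of "(-1) * s"] pos i dgap by (auto simp: open_gap_def)
      then show "?y ((-1) * s) \<notin> resonators N rp rm"
        using i by (intro in_gap_not_in_resonators[of _ "i"]) auto
    qed simp
    then show ?thesis
      by (simp add: x)
  qed
  then show ?thesis
    using boundary_flux_const[of "rm i"] pos by simp
qed

lemma capacitance_eq:
  assumes i: "i \<in> {1..N}" and j: "j \<in> {1..N}"
  shows "capacitance N rp rm i j =
          - 4 * pi * G (j - 1) * of_bool (i = j - 1)
          + 4 * pi * (G (j - 1) + G j) * of_bool (i = j)
          - 4 * pi * G j * of_bool (i = j + 1)"
proof -
  have "capacitance N rp rm i j = 4 * pi * (gap_charge j (i - 1) - gap_charge j i)"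
    using j by (simp add: capacitance_def potential_eq_shell_potential flux_outer[OF i] flux_inner[OF i] algebra_simps)
  \<comment> \<open>Rewrite the conditions on the gap as conditions on \<open>i\<close>; since \<^prop>\<open>1 \<le> i\<close>, the condition
    \<open>i - 1 = j - 1\<close> means \<open>i = j\<close> in spite of truncated subtraction.\<close>
  also have "\<dots> = 4 * pi * (G (i - 1) * (of_bool (i = j) - of_bool (i = j + 1))
      - G i * (of_bool (i = j - 1) - of_bool (i = j)))"
    using i j by (auto simp: gap_charge_def of_bool_def)
  also have "\<dots> = - 4 * pi * G (j - 1) * of_bool (i = j - 1)
          + 4 * pi * (G (j - 1) + G j) * of_bool (i = j)
          - 4 * pi * G j * of_bool (i = j + 1)"
    using i j by (auto simp: of_bool_def right_diff_distrib distrib_left)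
  finally show ?thesis .
qed

end

theorem lemma3p3:
  fixes N :: nat and rp rm :: "nat \<Rightarrow> real"
  assumes "N \<ge> 1"
    and "\<And>j. j \<in> {1..N} \<Longrightarrow> rp j > rm j"
    and "\<And>j. j \<in> {1..<N} \<Longrightarrow> rm j > rp (j + 1)"
    and "rm N > 0"
  shows
    "(\<forall>i\<in>{1..N}. \<forall>j\<in>{1..N}.
        capacitance N rp rm i j =
          - 4 * pi * gap_quotient N rp rm (j - 1) * of_bool (i = j - 1)
          + 4 * pi * (gap_quotient N rp rm (j - 1) + gap_quotient N rp rm j) * of_bool (i = j)
          - 4 * pi * gap_quotient N rp rm j * of_bool (i = j + 1))
     \<and> (\<forall>i\<in>{1..N}. \<forall>j\<in>{1..N}. capacitance N rp rm i j = capacitance N rp rm j i)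
     \<and> (\<forall>i\<in>{1..N}. \<forall>j\<in>{1..N}. \<bar>int i - int j\<bar> > 1 \<longrightarrow> capacitance N rp rm i j = 0)
     \<and> capacitance N rp rm 1 1 = 4 * pi * (rp 1 + gap_quotient N rp rm 1)
     \<and> (N \<ge> 2 \<longrightarrow>
          capacitance N rp rm 1 1 = 4 * pi * (rp 1 + rm 1 * rp 2 / (rm 1 - rp 2)))
     \<and> (\<forall>j. 2 \<le> j \<and> j \<le> N - 1 \<longrightarrow>
          capacitance N rp rm j j =
            4 * pi * (rm (j - 1) * rp j / (rm (j - 1) - rp j)
                      + rm j * rp (j + 1) / (rm j - rp (j + 1))))
     \<and> (N \<ge> 2 \<longrightarrow>
          capacitance N rp rm N N = 4 * pi * (rm (N - 1) * rp N / (rm (N - 1) - rp N)))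
     \<and> (\<forall>j. 1 \<le> j \<and> j \<le> N - 1 \<longrightarrow>
          capacitance N rp rm j (j + 1) = - 4 * pi * (rm j * rp (j + 1) / (rm j - rp (j + 1)))
          \<and> capacitance N rp rm (j + 1) j = - 4 * pi * (rm j * rp (j + 1) / (rm j - rp (j + 1))))"
proof -
  interpret nested_shells N rp rm
    using assms by unfold_locales auto
  have gap: "G k = rm k * rp (k + 1) / (rm k - rp (k + 1))" if "1 \<le> k" "k < N" for k
    using that by (simp add: gap_quotient_def)
  have "G 0 = rp 1" "G N = 0"
    using N_pos by (auto simp: gap_quotient_def)
  show ?thesis
    using \<open>G 0 = rp 1\<close> \<open>G N = 0\<close> N_pos
    by (intro conjI ballI allI impI; (rule capacitance_eq; assumption)?)
       (auto simp: capacitance_eq gap of_bool_def numeral_2_eq_2)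
qed

end
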